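(* Let $W$ be an $m\times n$ real matrix, let $k\le m$ and $l\le n$ be positive integers with $\operatorname{rank}(W)=r=\min\{k,l\}$, and let $h\ge1$ and $h'\ge1$. Suppose that the volume of a $k\times l$ submatrix $W_{\mathcal I,\mathcal J}$ of $W$ is nonzero and $(h,h')$-maximal in $W$. Then this volume is $hh'$-maximal over all $k\times l$ submatrices of $W$, that is, $v_2(B)\le hh'\,v_2(W_{\mathcal I,\mathcal J})$ for every $k\times l$ submatrix $B$ of $W$.
   Context: For a $k\times l$ matrix $M$ with singular values $\sigma_1(M)\ge\sigma_2(M)\ge\cdots$, the volume is $v_2(M)=\prod_{j=1}^{\min\{k,l\}}\sigma_j(M)$. For index sets $\mathcal I\subseteq\{1,\dots,m\}$, $\mathcal J\subseteq\{1,\dots,n\}$, $W_{\mathcal I,\mathcal J}$ is the submatrix of $W$ with rows in $\mathcal I$ and columns in $\mathcal J$, while $W_{\mathcal I,:}$ and $W_{:,\mathcal J}$ consist of full rows, respectively full columns. The volume of a $k\times l$ submatrix is $h$-maximal in a matrix if, multiplied by $h$, it is at least the volume of every $k\times l$ submatrix of that matrix. The volume of $W_{\mathcal I,\mathcal J}$ is $(h,h')$-maximal in $W$ if it is $h$-maximal in $W_{\mathcal I,:}$ (column-wise $h$-maximal) and $h'$-maximal in $W_{:,\mathcal J}$ (row-wise $h'$-maximal). *)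

theory Defs
  imports
    Jordan_Normal_Form.Char_Poly
    Jordan_Normal_Form.DL_Rank
    Jordan_Normal_Form.DL_Submatrix
    Complex_Main
begin

text \<open>
  Rows and columns are numbered from 0, so the index sets of an m by n matrix
  are subsets of \<open>{..<m}\<close> and \<open>{..<n}\<close>; singular values are numbered from 1.
\<close>

text \<open>
  The square roots of the eigenvalues of \<open>M\<^sup>T M\<close>, with algebraic multiplicity and in
  nonincreasing order.  Since \<open>M\<^sup>T M\<close> is symmetric, all roots of its characteristic
  polynomial are real and the list has length \<open>dim_col M\<close>.  If M is k by l with
  k < l, the last l - k entries are 0; they are not counted as singular values in
  \<open>volume\<close> below.
\<close>

definition singular_values :: "real mat \<Rightarrow> real list" where
  "singular_values M =
     rev (sorted_list_of_multiset
       (image_mset sqrt (proots (char_poly (transpose_mat M * M)))))"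

definition singular_value :: "real mat \<Rightarrow> nat \<Rightarrow> real" where
  "singular_value M j = singular_values M ! (j - 1)"

definition volume :: "real mat \<Rightarrow> real" where
  "volume M = (\<Prod>j = 1..min (dim_row M) (dim_col M). singular_value M j)"

definition is_submatrix :: "'a mat \<Rightarrow> 'a mat \<Rightarrow> bool" where
  "is_submatrix B A \<longleftrightarrow>
     (\<exists>I J. I \<subseteq> {..<dim_row A} \<and> J \<subseteq> {..<dim_col A} \<and> B = submatrix A I J)"

definition h_maximal :: "real \<Rightarrow> real mat \<Rightarrow> real mat \<Rightarrow> bool" where
  "h_maximal h B A \<longleftrightarrow> is_submatrix B A \<and>
     (\<forall>C. is_submatrix C A \<and> dim_row C = dim_row B \<and> dim_col C = dim_col B \<longrightarrow>
        volume C \<le> h * volume B)"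

definition hh_maximal :: "real \<Rightarrow> real \<Rightarrow> nat set \<Rightarrow> nat set \<Rightarrow> real mat \<Rightarrow> bool" where
  "hh_maximal h h' I J W \<longleftrightarrow>
     h_maximal h (submatrix W I J) (submatrix W I {..<dim_col W}) \<and>
     h_maximal h' (submatrix W I J) (submatrix W {..<dim_row W} J)"

end

theory Submission
  imports Defs
begin

text \<open>
  For a wide matrix the volume is \<open>sqrt (det (M * M\<^sup>T))\<close>, for a tall one it is
  \<open>sqrt (det (M\<^sup>T * M))\<close>.  Write \<open>W = X * Y\<close> with inner dimension r = min k l, so that
  \<open>W\<^sub>I\<^sub>J = X\<^sub>I * Y\<^sub>J\<close>, where one of the two factors is square.  Hence the volume of
  \<open>W\<^sub>I\<^sub>J\<close> is a product \<open>f I * g J\<close> of nonnegative numbers.  Column-wise maximality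
  bounds \<open>g\<close> by h times its value at J, row-wise maximality bounds \<open>f\<close> by h' times its
  value at I, and the two bounds multiply.
\<close>

section \<open>Spectrum of a real Gram matrix\<close>

text \<open>An eigenvector \<open>v\<close> satisfies
  \<open>z * (v \<bullet>c v) = ?w \<bullet>c ?w\<close> with \<open>?w = ?N *\<^sub>v v\<close>, so
  \<open>z\<close> is a nonnegative real divided by a positive one. The complex setting is needed
  because roots are only known to exist there.\<close>

lemma real_gram_eigenvalue:
  fixes N :: "real mat" and z :: complex
  assumes N: "N \<in> carrier_mat p q"
    and ev: "eigenvalue (map_mat of_real (N\<^sup>T * N)) z"
  shows "\<exists>c\<ge>0. z = of_real c"
proof -
  let ?N = "map_mat complex_of_real N"
  have N': "?N \<in> carrier_mat p q" using N by simp
  have eq: "map_mat complex_of_real (N\<^sup>T * N) = ?N\<^sup>T * ?N"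
    using N by (subst of_real_hom.mat_hom_mult[of _ q p _ q]) (auto simp: map_mat_transpose)
  obtain v where v: "v \<in> carrier_vec q" "v \<noteq> 0\<^sub>v q" and Nv: "(?N\<^sup>T * ?N) *\<^sub>v v = z \<cdot>\<^sub>v v"
    using ev N unfolding eigenvalue_def eigenvector_def eq by auto
  let ?w = "?N *\<^sub>v v"
  have w: "?w \<in> carrier_vec p" using N' v by simp
  \<comment> \<open>The entries of \<open>N\<close> are real, so conjugation passes through
    \<open>?N\<close>; this makes the transpose act as the adjoint.\<close>
  have cw: "?N *\<^sub>v conjugate v = conjugate ?w"
    using N v
    by (intro eq_vecI) (auto simp: scalar_prod_def conjugate_dist_mul row_def intro!: sum.cong)
  have "z * (v \<bullet>c v) = (z \<cdot>\<^sub>v v) \<bullet>c v" using v by simp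
  also have "\<dots> = (?N\<^sup>T *\<^sub>v ?w) \<bullet>c v" unfolding Nv[symmetric]
    using N' v by (subst assoc_mult_mat_vec[of _ q p _ q]) auto
  also have "\<dots> = ?w \<bullet> (?N *\<^sub>v conjugate v)"
    using N' v w by (intro transpose_vec_mult_scalar) auto
  finally have eq2: "z * (v \<bullet>c v) = ?w \<bullet>c ?w" unfolding cw .
  have a: "v \<bullet>c v > 0" "?w \<bullet>c ?w \<ge> 0" using v by auto
  then have "z = of_real (Re (?w \<bullet>c ?w) / Re (v \<bullet>c v))"
    using eq2 by (auto simp: less_complex_def less_eq_complex_def complex_eq_iff field_simps)
  moreover have "Re (?w \<bullet>c ?w) / Re (v \<bullet>c v) \<ge> 0" using a by (auto simp: less_complex_def less_eq_complex_def)
  ultimately show ?thesis by blast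
qed

text \<open>The polynomial splits over the complex numbers and all its roots are nonnegative reals;
  injectivity of the coefficient embedding brings the factorization back to the reals.\<close>

lemma char_poly_gram_factorized:
  fixes N :: "real mat"
  assumes N: "N \<in> carrier_mat p q"
  obtains cs where "char_poly (N\<^sup>T * N) = (\<Prod>c\<leftarrow>cs. [:-c, 1:])"
    "length cs = q" "\<forall>c\<in>set cs. 0 \<le> c"
proof -
  let ?A = "N\<^sup>T * N"
  have A: "?A \<in> carrier_mat q q" using N by simp
  then have A': "map_mat complex_of_real ?A \<in> carrier_mat q q" by simp
  obtain as where as: "char_poly (map_mat complex_of_real ?A) = (\<Prod>a\<leftarrow>as. [:-a, 1:])"
    and len: "length as = q"
    using char_poly_factorized[OF A'] by blast
  have real: "\<exists>c\<ge>0. a = of_real c" if "a \<in> set as" for a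
  proof (rule real_gram_eigenvalue[OF N])
    have "poly (char_poly (map_mat complex_of_real ?A)) a = 0"
      using that unfolding as poly_prod_list by (auto simp: prod_list_zero_iff image_iff intro!: bexI[of _ a])
    then show "eigenvalue (map_mat of_real ?A) a" using eigenvalue_root_char_poly[OF A'] by simp
  qed
  define cs where "cs = map Re as"
  interpret hom: map_poly_inj_idom_hom complex_of_real ..
  have "as = map of_real cs" unfolding cs_def map_map
    by (rule map_idI[symmetric]) (use real in force)
  then have "map_poly complex_of_real (char_poly ?A) = map_poly of_real (\<Prod>c\<leftarrow>cs. [:-c, 1:])"
    using as unfolding of_real_hom.char_poly_hom[OF A]
    by (simp add: hom.hom_prod_list o_def)
  then have "char_poly ?A = (\<Prod>c\<leftarrow>cs. [:-c, 1:])" by (rule hom.injectivity)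
  then show ?thesis using that[of cs] len real by (force simp: cs_def)
qed

section \<open>Characteristic polynomials of \<open>A * B\<close> and \<open>B * A\<close>\<close>

lemma const_mat_mult_uminus:
  fixes A B :: "'a :: comm_ring_1 mat"
  assumes "A \<in> carrier_mat p q" "B \<in> carrier_mat q s"
  shows "map_mat (\<lambda>a. [:a:]) A * (- map_mat (\<lambda>a. [:a:]) B) = map_mat (\<lambda>a. [:-a:]) (A * B)"
proof -
  have "(\<Sum>i\<in>S. [:f i:]) = [:\<Sum>i\<in>S. f i:]" for f :: "nat \<Rightarrow> 'a" and S
    by (induction S rule: infinite_finite_induct) auto
  then show ?thesis using assms
    by (intro eq_matI) (auto simp: scalar_prod_def sum_negf mult.commute)
qed

text \<open>Links \<open>M\<^sup>T * M\<close>, through which singular values are defined, with the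
  smaller \<open>M * M\<^sup>T\<close> of a wide matrix. Powers on both sides make a case
  distinction between \<open>p\<close> and \<open>q\<close> unnecessary.\<close>

lemma char_poly_mult_swap:
  fixes A B :: "'a :: idom mat"
  assumes A: "A \<in> carrier_mat p q" and B: "B \<in> carrier_mat q p"
  shows "[:0, 1:] ^ q * char_poly (A * B) = [:0, 1:] ^ p * char_poly (B * A)"
proof -
  let ?x = "[:0, 1:] :: 'a poly"
  let ?A = "map_mat (\<lambda>a. [:a:]) A" and ?B = "map_mat (\<lambda>a. [:a:]) B"
  let ?L = "four_block_mat (?x \<cdot>\<^sub>m 1\<^sub>m p) ?A ?B (1\<^sub>m q)"
  let ?R1 = "four_block_mat (1\<^sub>m p) (0\<^sub>m p q) (- ?B) (1\<^sub>m q)"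
  let ?R2 = "four_block_mat (1\<^sub>m p) (- ?A) (0\<^sub>m q p) (?x \<cdot>\<^sub>m 1\<^sub>m q)"
  have A': "?A \<in> carrier_mat p q" and B': "?B \<in> carrier_mat q p" using A B by auto
  have AB: "?x \<cdot>\<^sub>m 1\<^sub>m p + ?A * (- ?B) = char_poly_matrix (A * B)"
    "?x \<cdot>\<^sub>m 1\<^sub>m q + ?B * (- ?A) = char_poly_matrix (B * A)"
    using const_mat_mult_uminus[OF A B] const_mat_mult_uminus[OF B A] A B
    by (simp_all add: char_poly_matrix_def del: uminus_mult_right_mat)
  have L: "?L \<in> carrier_mat (p + q) (p + q)"
    and R: "?R1 \<in> carrier_mat (p + q) (p + q)" "?R2 \<in> carrier_mat (p + q) (p + q)"
    by auto
  \<comment> \<open>Right multiplication clears the upper right or the lower left block of \<open>?L\<close>;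
     comparing the two determinants gives Sylvester's identity.\<close>
  have L1: "?L * ?R1 = four_block_mat (char_poly_matrix (A * B)) ?A (0\<^sub>m q p) (1\<^sub>m q)"
    using A' B' unfolding AB(1)[symmetric]
    by (subst mult_four_block_mat[of _ p p _ q _ q _ _ p _ q]) auto
  have L2: "?L * ?R2 = four_block_mat (?x \<cdot>\<^sub>m 1\<^sub>m p) (0\<^sub>m p q) ?B (char_poly_matrix (B * A))"
    using A' B' unfolding AB(2)[symmetric]
    by (subst mult_four_block_mat[of _ p p _ q _ q _ _ p _ q])
      (auto simp: mult_smult_distrib[of _ p q _ q] mult_smult_assoc_mat[of _ p p _ q])
  have "det ?L = det (?L * ?R1)" using L R A' B'
    by (simp add: det_mult[of _ "p + q"] det_four_block_mat_upper_right_zero[of _ p _ q])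
  also have "\<dots> = char_poly (A * B)" unfolding L1 using A B A'
    by (subst det_four_block_mat_lower_left_zero[of _ p _ q]) (auto simp: char_poly_def)
  finally have 1: "det ?L = char_poly (A * B)" .
  have "det (?L * ?R2) = det ?L * ?x ^ q"  using L R A' B'
    by (simp add: det_mult[of _ "p+q"] det_four_block_mat_lower_left_zero[of _ p _ q] )
  moreover have "det (?L * ?R2) = ?x ^ p * char_poly (B * A)" unfolding L2 using A B B'
    by (subst det_four_block_mat_upper_right_zero[of _ p _ q]) (auto simp: char_poly_def)
  ultimately show ?thesis using 1 by (simp add: mult.commute)
qed

section \<open>Volumes as Gram determinants\<close>

text \<open>At 0 the characteristic polynomial takes the value \<open>det (- A)\<close>, and its
  factorization gives the product of the negated roots; the signs cancel.\<close>

lemma det_eq_prod_roots: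
  fixes A :: "'a :: field mat"
  assumes A: "A \<in> carrier_mat n n" and cp: "char_poly A = (\<Prod>c\<leftarrow>cs. [:-c, 1:])"
  shows "det A = prod_list cs"
proof -
  have len: "length cs = n"
    using degree_monic_char_poly[OF A] degree_linear_factors[of uminus cs] cp by auto
  have *: "poly (\<Prod>c\<leftarrow>cs. [:-c, 1:]) 0 = (-1) ^ length cs * prod_list cs"
    by (induction cs) auto
  have "- char_matrix A 0 = (-1) \<cdot>\<^sub>m A" using A by (intro eq_matI) (auto simp: char_matrix_def)
  then have "(-1) ^ n * prod_list cs = (-1) ^ n * det A"
    using char_poly_matrix[OF A, of 0] * A unfolding cp len by (simp add: det_smult)
  then show ?thesis by simp
qed

lemma rev_sort_append_replicate_zero:
  fixes xs :: "'a :: {linorder, zero} list"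
  assumes "\<forall>x\<in>set xs. 0 \<le> x"
  shows "rev (sort (xs @ replicate d 0)) = rev (sort xs) @ replicate d 0"
proof -
  have "sort (xs @ replicate d 0) = replicate d 0 @ sort xs"
    using assms by (intro properties_for_sort) (auto simp: sorted_append)
  then show ?thesis by simp
qed

text \<open>Serves tall and wide matrices alike: \<open>d\<close> counts the surplus zero
  eigenvalues of \<open>M\<^sup>T * M\<close>. Being smallest, they stand last in the list of
  singular values, beyond the factors that the volume takes.\<close>

lemma volume_eq_sqrt_prod_list:
  assumes roots: "proots (char_poly (M\<^sup>T * M)) = mset cs + replicate_mset d 0"
    and nonneg: "\<forall>c\<in>set cs. 0 \<le> c"
    and len: "length cs = min (dim_row M) (dim_col M)"
  shows "volume M = sqrt (prod_list cs)" "0 \<le> volume M"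
proof -
  define ss where "ss = rev (sort (map sqrt cs))"
  have mset_eq: "image_mset sqrt (mset cs + replicate_mset d 0) = mset (map sqrt cs @ replicate d 0)"
    by simp
  have "singular_values M = rev (sort (map sqrt cs @ replicate d 0))"
    unfolding singular_values_def roots mset_eq sorted_list_of_multiset_mset ..
  also have "\<dots> = ss @ replicate d 0"
    unfolding ss_def using nonneg by (intro rev_sort_append_replicate_zero) auto
  finally have "singular_values M = ss @ replicate d 0" .
  moreover have "length ss = min (dim_row M) (dim_col M)" using len by (simp add: ss_def)
  ultimately have "volume M = (\<Prod>j = 1..length ss. (ss @ replicate d 0) ! (j - 1))"
    by (simp add: volume_def singular_value_def)
  \<comment> \<open>The shift passes from singular values numbered from 1 to list positions numbered
    from 0; the padding is never reached.\<close>
  also have "\<dots> = (\<Prod>j < length ss. ss ! j)"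
    by (rule prod.reindex_bij_witness[of _ Suc "\<lambda>j. j - 1"]) (auto simp: nth_append)
  also have "\<dots> = prod_list ss" by (simp add: prod.list_conv_set_nth atLeast0LessThan)
  also have "\<dots> = prod_list (map sqrt cs)"
    by (metis ss_def mset_rev mset_sort prod_mset_prod_list)
  also have "\<dots> = sqrt (prod_list cs)"
    by (induction cs) (auto simp: real_sqrt_mult)
  finally show eq: "volume M = sqrt (prod_list cs)" .
  have "0 \<le> prod_list cs" using nonneg by (induction cs) auto
  then show "0 \<le> volume M" by (simp add: eq)
qed

lemma proots_linear_factors:
  "proots (\<Prod>c\<leftarrow>cs. [:-c, 1:] :: 'a :: idom poly) = mset cs"
proof (induction cs)
  case (Cons c cs)
  have "(\<Prod>c\<leftarrow>cs. [:-c, 1:] :: 'a poly) \<noteq> 0" by (auto simp: prod_list_zero_iff)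
  then show ?case using Cons by (simp add: proots_mult del: mult_pCons_left)
qed simp

lemma volume_tall:
  assumes M: "M \<in> carrier_mat p q" and "q \<le> p"
  shows "volume M = sqrt (det (M\<^sup>T * M))" "0 \<le> volume M"
proof -
  obtain cs where cs: "char_poly (M\<^sup>T * M) = (\<Prod>c\<leftarrow>cs. [:-c, 1:])"
    "length cs = q" "\<forall>c\<in>set cs. 0 \<le> c"
    using char_poly_gram_factorized[OF M] .
  have "volume M = sqrt (prod_list cs) \<and> 0 \<le> volume M"
    using volume_eq_sqrt_prod_list[of M cs 0] cs assms by (auto simp: proots_linear_factors)
  then show "volume M = sqrt (det (M\<^sup>T * M))" "0 \<le> volume M"
    using det_eq_prod_roots[OF _ cs(1), of q] M by auto
qed

text \<open>By the swap identity, \<open>M\<^sup>T * M\<close> has the eigenvalues of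
  \<open>M * M\<^sup>T\<close> and \<open>q - p\<close> further zeros, exactly those that the volume
  leaves out.\<close>

lemma volume_wide:
  assumes M: "M \<in> carrier_mat p q" and "p \<le> q"
  shows "volume M = sqrt (det (M * M\<^sup>T))" "0 \<le> volume M"
proof -
  have Mt: "M\<^sup>T \<in> carrier_mat q p" using M by simp
  obtain cs where cs: "char_poly (M * M\<^sup>T) = (\<Prod>c\<leftarrow>cs. [:-c, 1:])"
    "length cs = p" "\<forall>c\<in>set cs. 0 \<le> c"
    using char_poly_gram_factorized[OF Mt] by auto
  define x :: "real poly" where "x = [:0, 1:]"
  have x: "x \<noteq> 0" and roots_x: "proots (x ^ d) = replicate_mset d 0" for d
    using proots_linear_factor[of "0::real"] by (simp_all add: x_def proots_power)
  \<comment> \<open>Splitting \<open>x ^ q\<close> exposes the factor \<open>x ^ p\<close> that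
    cancels against the other side of the swap identity.\<close>
  have "x ^ p * (x ^ (q - p) * char_poly (M * M\<^sup>T)) = x ^ q * char_poly (M * M\<^sup>T)"
    using \<open>p \<le> q\<close> by (simp add: power_add[symmetric] mult.assoc[symmetric])
  also have "\<dots> = x ^ p * char_poly (M\<^sup>T * M)"
    using char_poly_mult_swap[OF M Mt] by (simp add: x_def)
  finally have "char_poly (M\<^sup>T * M) = x ^ (q - p) * (\<Prod>c\<leftarrow>cs. [:-c, 1:])"
    using x cs(1) by simp
  moreover have "(\<Prod>c\<leftarrow>cs. [:-c, 1:] :: real poly) \<noteq> 0" by (auto simp: prod_list_zero_iff)
  ultimately have "proots (char_poly (M\<^sup>T * M)) = mset cs + replicate_mset (q - p) 0"
    using x by (simp add: proots_mult proots_linear_factors roots_x)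
  then have "volume M = sqrt (prod_list cs) \<and> 0 \<le> volume M"
    using volume_eq_sqrt_prod_list[of M cs "q - p"] cs assms by auto
  then show "volume M = sqrt (det (M * M\<^sup>T))" "0 \<le> volume M"
    using det_eq_prod_roots[OF _ cs(1), of p] M by auto
qed

section \<open>Volume of a product with a square factor\<close>

text \<open>The Gram matrix of the product is \<open>X * (Y * Y\<^sup>T) * X\<^sup>T\<close>, a
  product of square matrices, so its determinant gains the factor
  \<open>(det X)\<^sup>2\<close>.\<close>

lemma volume_square_mult:
  assumes X: "X \<in> carrier_mat p p" and Y: "Y \<in> carrier_mat p q" and "p \<le> q"
  shows "volume (X * Y) = \<bar>det X\<bar> * volume Y"
proof -
  have "(X * Y) * (X * Y)\<^sup>T = (X * (Y * Y\<^sup>T)) * X\<^sup>T"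
    using X Y by (simp add: transpose_mult[OF X Y] assoc_mult_mat[of _ p p _ q _ p]
        assoc_mult_mat[of _ p q _ p _ p] assoc_mult_mat[of _ p p _ p _ p])
  then have "det ((X * Y) * (X * Y)\<^sup>T) = (det X)\<^sup>2 * det (Y * Y\<^sup>T)"
    using X Y by (simp add: det_mult[of _ p] det_transpose power2_eq_square)
  moreover have "volume (X * Y) = sqrt (det ((X * Y) * (X * Y)\<^sup>T))"
    "volume Y = sqrt (det (Y * Y\<^sup>T))"
    using volume_wide[of "X * Y" p q] volume_wide[of Y p q] assms by auto
  ultimately show ?thesis by (simp add: real_sqrt_mult)
qed

lemma volume_mult_square:
  assumes X: "X \<in> carrier_mat p q" and Y: "Y \<in> carrier_mat q q" and "q \<le> p"
  shows "volume (X * Y) = volume X * \<bar>det Y\<bar>"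
proof -
  have "(X * Y)\<^sup>T * (X * Y) = (Y\<^sup>T * (X\<^sup>T * X)) * Y"
    using X Y by (simp add: transpose_mult[OF X Y] assoc_mult_mat[of _ q q _ p _ q]
        assoc_mult_mat[of _ q p _ q _ q] assoc_mult_mat[of _ q q _ q _ q])
  then have "det ((X * Y)\<^sup>T * (X * Y)) = (det Y)\<^sup>2 * det (X\<^sup>T * X)"
    using X Y by (simp add: det_mult[of _ q] det_transpose power2_eq_square)
  moreover have "volume (X * Y) = sqrt (det ((X * Y)\<^sup>T * (X * Y)))"
    "volume X = sqrt (det (X\<^sup>T * X))"
    using volume_tall[of "X * Y" p q] volume_tall[of X p q] assms by auto
  ultimately show ?thesis by (simp add: real_sqrt_mult)
qed

section \<open>Rank factorization\<close>

text \<open>The columns of \<open>X\<close> form a maximal independent set of columns of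
  \<open>A\<close>; those of \<open>Y\<close> are the coordinates of the columns of \<open>A\<close>
  in this basis.\<close>

lemma (in vec_space) rank_factorization:
  assumes A: "A \<in> carrier_mat n nc"
  obtains X Y where "X \<in> carrier_mat n (rank A)" "Y \<in> carrier_mat (rank A) nc" "A = X * Y"
proof -
  let ?C = "set (cols A)"
  have C: "?C \<subseteq> carrier_vec n" using cols_dim A by blast
  obtain S where fin: "finite S" and max: "maximal S (\<lambda>T. T \<subseteq> ?C \<and> lin_indpt T)"
    using maximal_exists_superset[of ?C "\<lambda>T. T \<subseteq> ?C \<and> lin_indpt T" "{}"]
      finite_lin_indpt2[of "{}"] by auto
  have SC: "S \<subseteq> ?C" and indpt: "lin_indpt S" using max by (auto simp: maximal_def)
  have spanC: "w \<in> span S" if w: "w \<in> ?C" for w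
  proof (cases "w \<in> S")
    case True
    then show ?thesis using in_own_span SC C by auto
  next
    case False
    \<comment> \<open>Maximality of \<open>S\<close> forbids enlarging it by \<open>w\<close>, and a
      dependency of the enlarged set must involve \<open>w\<close>.\<close>
    then have "lin_dep (insert w S)"
      using max w SC unfolding maximal_def by blast
    then show ?thesis
      using lin_dep_iff_in_span[of S w] False w SC C indpt by auto
  qed
  obtain bs where bs: "set bs = S" "distinct bs" using fin finite_distinct_list by blast
  have len: "length bs = rank A"
    using rank_card_indpt[OF A max] bs distinct_card[of bs] by simp
  define X where "X = mat_of_cols n bs"
  have colsX: "cols X = bs" unfolding X_def using bs SC C by (intro cols_mat_of_cols) auto
  have X: "X \<in> carrier_mat n (rank A)" unfolding X_def len[symmetric] by (rule mat_of_cols_carrier(1))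
  have "\<exists>y \<in> carrier_vec (rank A). w = X *\<^sub>v y" if "w \<in> ?C" for w
  proof -
    obtain a where "w = lincomb a S"
      using spanC[OF \<open>w \<in> ?C\<close>] finite_span[OF fin] SC C by auto
    \<comment> \<open>The enumeration \<open>bs\<close> turns coefficients indexed by vectors into a
      coordinate vector; its distinctness keeps any summand from being counted twice.\<close>
    then have "w = X *\<^sub>v vec (rank A) (\<lambda>i. a (col X i))"
      using mat_mult_eq_lincomb[OF X, of a] colsX bs by simp
    then show ?thesis by (intro bexI) auto
  qed
  then obtain f where f: "\<And>w. w \<in> ?C \<Longrightarrow> f w \<in> carrier_vec (rank A) \<and> w = X *\<^sub>v f w"
    by metis
  define Y where "Y = mat_of_cols (rank A) (map f (cols A))"
  have Y: "Y \<in> carrier_mat (rank A) nc"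
    using A mat_of_cols_carrier(1)[of "rank A" "map f (cols A)"] by (simp add: Y_def)
  have "A = X * Y"
  proof (rule mat_col_eqI)
    fix j assume "j < dim_col (X * Y)"
    then have j: "j < nc" using Y by simp
    then have "col A j \<in> ?C" using A by (metis carrier_matD(2) cols_length cols_nth nth_mem)
    then have f': "f (col A j) \<in> carrier_vec (rank A)" "col A j = X *\<^sub>v f (col A j)" using f by auto
    have "col (X * Y) j = X *\<^sub>v col Y j" using X Y j by (intro col_mult2) auto
    also have "col Y j = f (col A j)" unfolding Y_def using j A f' by (subst col_mat_of_cols) auto
    finally show "col A j = col (X * Y) j" using f' by simp
  qed (use A X Y in auto)
  then show ?thesis using that X Y by blast
qed

section \<open>Submatrices of products and of submatrices\<close>

lemma submatrix_carrier:
  assumes "A \<in> carrier_mat m n" "I \<subseteq> {..<m}" "J \<subseteq> {..<n}"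
  shows "submatrix A I J \<in> carrier_mat (card I) (card J)"
proof -
  have "{i. i < m \<and> i \<in> I} = I" "{i. i < n \<and> i \<in> J} = J" using assms by auto
  then show ?thesis using assms(1) by (intro carrier_matI) (simp_all add: dim_submatrix)
qed

lemma pick_lessThan: "i < k \<Longrightarrow> pick {..<k} i = i"
  using pick_reduce_set[of i k UNIV] by (simp add: pick_UNIV lessThan_def)

text \<open>Rows are selected in the left factor and columns in the right one; the inner index runs
  over all of \<open>{..<r}\<close>, where \<open>pick\<close> is the identity.\<close>

lemma submatrix_mult:
  fixes X Y :: "'a :: semiring_0 mat"
  assumes X: "X \<in> carrier_mat m r" and Y: "Y \<in> carrier_mat r n"
  shows "submatrix (X * Y) I J = submatrix X I {..<r} * submatrix Y {..<r} J"
proof (rule eq_matI)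
  fix i j
  assume "i < dim_row (submatrix X I {..<r} * submatrix Y {..<r} J)"
    and "j < dim_col (submatrix X I {..<r} * submatrix Y {..<r} J)"
  then have i: "i < card {i. i < m \<and> i \<in> I}" and j: "j < card {j. j < n \<and> j \<in> J}"
    using X Y by (simp_all add: dim_submatrix)
  show "submatrix (X * Y) I J $$ (i, j) = (submatrix X I {..<r} * submatrix Y {..<r} J) $$ (i, j)"
    using X Y i j pick_le[OF i] pick_le[OF j]
    by (simp add: dim_submatrix submatrix_index pick_lessThan scalar_prod_def)
qed (use X Y in \<open>simp_all add: dim_submatrix\<close>)

text \<open>The selected rows are renumbered from 0, so inside the row strip the full row set is
  \<open>{..<card I}\<close>. This places \<open>k\<close> by \<open>l\<close> submatrices in the
  strip that the maximality hypothesis speaks of.\<close>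

lemma submatrix_submatrix_rows:
  assumes "A \<in> carrier_mat m n" "I \<subseteq> {..<m}" "J \<subseteq> {..<n}"
  shows "submatrix (submatrix A I {..<n}) {..<card I} J = submatrix A I J"
proof -
  have "{i. i < m \<and> i \<in> I} = I" "{i. i < n \<and> i \<in> J} = J" using assms by auto
  moreover have "pick J j < n" if "j < card J" for j
    using pick_in_set[of j J] that assms by auto
  ultimately show ?thesis using assms(1)
    by (intro eq_matI) (simp_all add: dim_submatrix submatrix_index pick_lessThan)
qed

lemma submatrix_submatrix_cols:
  assumes "A \<in> carrier_mat m n" "I \<subseteq> {..<m}" "J \<subseteq> {..<n}"
  shows "submatrix (submatrix A {..<m} J) I {..<card J} = submatrix A I J"
proof -
  have "{i. i < m \<and> i \<in> I} = I" "{i. i < n \<and> i \<in> J} = J" using assms by auto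
  moreover have "pick I j < m" if "j < card I" for j
    using pick_in_set[of j I] that assms by auto
  ultimately show ?thesis using assms(1)
    by (intro eq_matI) (simp_all add: dim_submatrix submatrix_index pick_lessThan)
qed

section \<open>Combining the two maximality bounds\<close>

text \<open>A nonzero product makes \<open>a\<close> and \<open>b\<close> positive, so they cancel
  from the two bounds. The results multiply because \<open>0 \<le> b'\<close> and
  \<open>0 \<le> a' \<le> h' * a\<close>.\<close>

lemma cross_bound:
  fixes a b a' b' h h' :: real
  assumes "0 \<le> a" "0 \<le> b" "0 \<le> a'" "0 \<le> b'" "a * b \<noteq> 0"
    and ab': "a * b' \<le> h * (a * b)" and a'b: "a' * b \<le> h' * (a * b)"
  shows "a' * b' \<le> h * h' * (a * b)"
proof -
  have "a > 0" "b > 0" using assms by auto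
  then have "b' \<le> h * b" "a' \<le> h' * a" using ab' a'b by (auto simp: ac_simps)
  then have "a' * b' \<le> (h' * a) * (h * b)"
    using assms by (intro mult_mono) auto
  then show ?thesis by (simp add: ac_simps)
qed

theorem theorem11p1:
  fixes W :: "real mat" and m n k l r :: nat and h h' :: real and I J :: "nat set"
  assumes "W \<in> carrier_mat m n"
    and "1 \<le> k" and "k \<le> m" and "1 \<le> l" and "l \<le> n"
    and "vec_space.rank m W = r" and "r = min k l"
    and "h \<ge> 1" and "h' \<ge> 1"
    and "I \<subseteq> {..<m}" and "card I = k"
    and "J \<subseteq> {..<n}" and "card J = l"
    and "volume (submatrix W I J) \<noteq> 0"
    and "hh_maximal h h' I J W"
  shows "\<forall>B. B \<in> carrier_mat k l \<and> is_submatrix B W \<longrightarrow>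
    volume B \<le> h * h' * volume (submatrix W I J)"
proof (intro allI impI)
  fix B assume B: "B \<in> carrier_mat k l \<and> is_submatrix B W"
  note W = assms(1)
  obtain I' J' where I': "I' \<subseteq> {..<m}" and J': "J' \<subseteq> {..<n}" and B': "B = submatrix W I' J'"
    using B W unfolding is_submatrix_def by auto
  have cards: "card I' = k" "card J' = l"
    using submatrix_carrier[OF W I' J'] B unfolding B' by auto
  obtain X Y where X: "X \<in> carrier_mat m r" and Y: "Y \<in> carrier_mat r n" and WXY: "W = X * Y"
    using vec_space.rank_factorization[OF W] assms(6) by metis
  have sub: "submatrix X S {..<r} \<in> carrier_mat (card S) r"
    "submatrix Y {..<r} T \<in> carrier_mat r (card T)"
    "submatrix W S T = submatrix X S {..<r} * submatrix Y {..<r} T"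
    if "S \<subseteq> {..<m}" "T \<subseteq> {..<n}" for S T
    using submatrix_carrier[OF X, of S "{..<r}"] submatrix_carrier[OF Y, of "{..<r}" T]
      submatrix_mult[OF X Y, of S T] that WXY by simp_all
  \<comment> \<open>One pair \<open>f\<close>, \<open>g\<close> must work for all index sets of the
    right sizes, since it is evaluated at all four combinations of \<open>I\<close>,
    \<open>I'\<close> with \<open>J\<close>, \<open>J'\<close>.\<close>
  have "\<exists>f g. \<forall>S T. S \<subseteq> {..<m} \<longrightarrow> T \<subseteq> {..<n} \<longrightarrow> card S = k \<longrightarrow> card T = l \<longrightarrow>
    0 \<le> f S \<and> 0 \<le> g T \<and> volume (submatrix W S T) = f S * g T"
  proof (cases "k \<le> l")
    case True
    \<comment> \<open>Here the rows of \<open>X\<close> chosen by \<open>S\<close> form a square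
      block, which contributes its absolute determinant.\<close>
    then have r: "r = k" using assms(7) by simp
    show ?thesis
    proof (intro exI allI impI)
      fix S T assume "S \<subseteq> {..<m}" "T \<subseteq> {..<n}" "card S = k" "card T = l"
      then show "0 \<le> \<bar>det (submatrix X S {..<r})\<bar> \<and> 0 \<le> volume (submatrix Y {..<r} T) \<and>
        volume (submatrix W S T) = \<bar>det (submatrix X S {..<r})\<bar> * volume (submatrix Y {..<r} T)"
        using sub[of S T] volume_wide(2)[OF _ True] volume_square_mult[OF _ _ True] r by simp
    qed
  next
    case False
    \<comment> \<open>Now the square block consists of the columns of \<open>Y\<close> chosen by
      \<open>T\<close>.\<close>
    then have r: "r = l" and lk: "l \<le> k" using assms(7) by simp_all
    show ?thesis
    proof (intro exI allI impI)
      fix S T assume "S \<subseteq> {..<m}" "T \<subseteq> {..<n}" "card S = k" "card T = l"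
      then show "0 \<le> volume (submatrix X S {..<r}) \<and> 0 \<le> \<bar>det (submatrix Y {..<r} T)\<bar> \<and>
        volume (submatrix W S T) = volume (submatrix X S {..<r}) * \<bar>det (submatrix Y {..<r} T)\<bar>"
        using sub[of S T] volume_tall(2)[OF _ lk] volume_mult_square[OF _ _ lk] r by simp
    qed
  qed
  then obtain f g where fg: "\<And>S T. S \<subseteq> {..<m} \<Longrightarrow> T \<subseteq> {..<n} \<Longrightarrow> card S = k \<Longrightarrow> card T = l \<Longrightarrow>
    0 \<le> f S \<and> 0 \<le> g T \<and> volume (submatrix W S T) = f S * g T" by metis
  have IJ: "submatrix W I J \<in> carrier_mat k l"
    "submatrix W I J' \<in> carrier_mat k l"
    "submatrix W I' J \<in> carrier_mat k l"
    using submatrix_carrier[OF W] assms I' J' cards by metis+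
  \<comment> \<open>The mixed submatrices, with one index set from the given block and one from
    \<open>B\<close>, are the competitors to which the two hypotheses apply.\<close>
  have "is_submatrix (submatrix W I J') (submatrix W I {..<n})"
    using submatrix_submatrix_rows[OF W assms(10) J'] submatrix_carrier[OF W assms(10), of "{..<n}"] J'
    unfolding is_submatrix_def by (intro exI[of _ "{..<card I}"] exI[of _ J']) auto
  then have 1: "volume (submatrix W I J') \<le> h * volume (submatrix W I J)"
    using assms(15) IJ W unfolding hh_maximal_def h_maximal_def by auto
  have "is_submatrix (submatrix W I' J) (submatrix W {..<m} J)"
    using submatrix_submatrix_cols[OF W I' assms(12)] submatrix_carrier[OF W _ assms(12), of "{..<m}"] I'
    unfolding is_submatrix_def by (intro exI[of _ "{..<card J}"] exI[of _ I']) auto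
  then have 2: "volume (submatrix W I' J) \<le> h' * volume (submatrix W I J)"
    using assms(15) IJ W unfolding hh_maximal_def h_maximal_def by auto
  note fg' = fg[OF assms(10,12,11,13)] fg[OF assms(10) J' assms(11) cards(2)]
    fg[OF I' assms(12) cards(1) assms(13)] fg[OF I' J' cards]
  show "volume B \<le> h * h' * volume (submatrix W I J)"
    using cross_bound[of "f I" "g J" "f I'" "g J'" h h'] 1 2 assms(14) fg' unfolding B' by simp
qed

end
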